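(* Let $Q$ be a commutative A-loop. For $n\ge 0$ let $K_n(Q)=\{x^{2^n} : x\in Q\}$ and let $K(Q)=\bigcap_{n\ge 1}K_n(Q)$. Then: (i) $K_{n+1}(Q)=\{x^2 : x\in K_n(Q)\}$ for every $n\ge 0$; (ii) $K_{n+1}(Q)\subseteq K_n(Q)$ for every $n\ge 0$; (iii) $K_n(Q)$ is a normal subloop of $Q$ for every $n\ge 0$; (iv) $K(Q)$ is a normal subloop of $Q$; (v) if $Q$ is finite, then $K(Q)=\{x\in Q : |x| \text{ is odd}\}$ and $|K(Q)|$ is odd.
   Context: A loop is a set with a binary operation and neutral element $1$ in which all left and right translations are bijections; $\mathrm{Inn}(Q)$ is the stabilizer of $1$ in the group generated by all translations. A commutative A-loop is a commutative loop all of whose inner mappings are automorphisms. Such loops are power-associative, powers $x^n$ being computed in the cyclic group generated by $x$; $|x|$ is the order of $x$. A normal subloop is a subloop invariant under all inner mappings. *)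

theory Defs
  imports Main
begin

definition loop :: "'a set \<Rightarrow> ('a \<Rightarrow> 'a \<Rightarrow> 'a) \<Rightarrow> 'a \<Rightarrow> bool" where
  "loop Q m e \<longleftrightarrow> e \<in> Q \<and> (\<forall>x\<in>Q. \<forall>y\<in>Q. m x y \<in> Q)
     \<and> (\<forall>x\<in>Q. m e x = x \<and> m x e = x)
     \<and> (\<forall>x\<in>Q. bij_betw (\<lambda>y. m x y) Q Q \<and> bij_betw (\<lambda>y. m y x) Q Q)"

definition Ltr :: "'a set \<Rightarrow> ('a \<Rightarrow> 'a \<Rightarrow> 'a) \<Rightarrow> 'a \<Rightarrow> 'a \<Rightarrow> 'a" where
  "Ltr Q m x = (\<lambda>y. if y \<in> Q then m x y else y)"

definition Rtr :: "'a set \<Rightarrow> ('a \<Rightarrow> 'a \<Rightarrow> 'a) \<Rightarrow> 'a \<Rightarrow> 'a \<Rightarrow> 'a" where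
  "Rtr Q m x = (\<lambda>y. if y \<in> Q then m y x else y)"

definition Ltr_inv :: "'a set \<Rightarrow> ('a \<Rightarrow> 'a \<Rightarrow> 'a) \<Rightarrow> 'a \<Rightarrow> 'a \<Rightarrow> 'a" where
  "Ltr_inv Q m x = (\<lambda>y. if y \<in> Q then (THE z. z \<in> Q \<and> m x z = y) else y)"

definition Rtr_inv :: "'a set \<Rightarrow> ('a \<Rightarrow> 'a \<Rightarrow> 'a) \<Rightarrow> 'a \<Rightarrow> 'a \<Rightarrow> 'a" where
  "Rtr_inv Q m x = (\<lambda>y. if y \<in> Q then (THE z. z \<in> Q \<and> m z x = y) else y)"

inductive_set Mlt :: "'a set \<Rightarrow> ('a \<Rightarrow> 'a \<Rightarrow> 'a) \<Rightarrow> ('a \<Rightarrow> 'a) set"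
  for Q :: "'a set" and m :: "'a \<Rightarrow> 'a \<Rightarrow> 'a" where
  Mlt_id: "id \<in> Mlt Q m"
| Mlt_L: "f \<in> Mlt Q m \<Longrightarrow> x \<in> Q \<Longrightarrow> Ltr Q m x \<circ> f \<in> Mlt Q m"
| Mlt_R: "f \<in> Mlt Q m \<Longrightarrow> x \<in> Q \<Longrightarrow> Rtr Q m x \<circ> f \<in> Mlt Q m"
| Mlt_Linv: "f \<in> Mlt Q m \<Longrightarrow> x \<in> Q \<Longrightarrow> Ltr_inv Q m x \<circ> f \<in> Mlt Q m"
| Mlt_Rinv: "f \<in> Mlt Q m \<Longrightarrow> x \<in> Q \<Longrightarrow> Rtr_inv Q m x \<circ> f \<in> Mlt Q m"

definition Inn :: "'a set \<Rightarrow> ('a \<Rightarrow> 'a \<Rightarrow> 'a) \<Rightarrow> 'a \<Rightarrow> ('a \<Rightarrow> 'a) set" where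
  "Inn Q m e = {f \<in> Mlt Q m. f e = e}"

definition loop_aut :: "'a set \<Rightarrow> ('a \<Rightarrow> 'a \<Rightarrow> 'a) \<Rightarrow> ('a \<Rightarrow> 'a) \<Rightarrow> bool" where
  "loop_aut Q m f \<longleftrightarrow> bij_betw f Q Q \<and> (\<forall>x\<in>Q. \<forall>y\<in>Q. f (m x y) = m (f x) (f y))"

definition comm_A_loop :: "'a set \<Rightarrow> ('a \<Rightarrow> 'a \<Rightarrow> 'a) \<Rightarrow> 'a \<Rightarrow> bool" where
  "comm_A_loop Q m e \<longleftrightarrow> loop Q m e \<and> (\<forall>x\<in>Q. \<forall>y\<in>Q. m x y = m y x)
     \<and> (\<forall>f\<in>Inn Q m e. loop_aut Q m f)"

text \<open>Powers (loops considered here are power-associative, so any bracketing works).\<close>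

primrec lpow :: "('a \<Rightarrow> 'a \<Rightarrow> 'a) \<Rightarrow> 'a \<Rightarrow> 'a \<Rightarrow> nat \<Rightarrow> 'a" where
  "lpow m e x 0 = e"
| "lpow m e x (Suc n) = m x (lpow m e x n)"

text \<open>Order of an element: least positive n with x^n = 1 (meaningful in the finite case).\<close>

definition lord :: "('a \<Rightarrow> 'a \<Rightarrow> 'a) \<Rightarrow> 'a \<Rightarrow> 'a \<Rightarrow> nat" where
  "lord m e x = (LEAST n. 0 < n \<and> lpow m e x n = e)"

definition subloop :: "'a set \<Rightarrow> ('a \<Rightarrow> 'a \<Rightarrow> 'a) \<Rightarrow> 'a \<Rightarrow> 'a set \<Rightarrow> bool" where
  "subloop Q m e S \<longleftrightarrow> S \<subseteq> Q \<and> e \<in> S \<and> (\<forall>x\<in>S. \<forall>y\<in>S. m x y \<in> S)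
     \<and> (\<forall>x\<in>S. \<forall>y\<in>S. \<forall>z\<in>Q. (m x z = y \<longrightarrow> z \<in> S) \<and> (m z x = y \<longrightarrow> z \<in> S))"

definition normal_subloop :: "'a set \<Rightarrow> ('a \<Rightarrow> 'a \<Rightarrow> 'a) \<Rightarrow> 'a \<Rightarrow> 'a set \<Rightarrow> bool" where
  "normal_subloop Q m e S \<longleftrightarrow> subloop Q m e S \<and> (\<forall>f\<in>Inn Q m e. f ` S \<subseteq> S)"

definition Kn :: "'a set \<Rightarrow> ('a \<Rightarrow> 'a \<Rightarrow> 'a) \<Rightarrow> 'a \<Rightarrow> nat \<Rightarrow> 'a set" where
  "Kn Q m e n = {lpow m e x (2 ^ n) | x. x \<in> Q}"

definition Kinf :: "'a set \<Rightarrow> ('a \<Rightarrow> 'a \<Rightarrow> 'a) \<Rightarrow> 'a \<Rightarrow> 'a set" where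
  "Kinf Q m e = (\<Inter>n\<in>{1..}. Kn Q m e n)"

end

theory Submission
  imports Defs
begin

text \<open>
  Write \<open>T x y = L\<^bsub>xy\<^esub>\<inverse> L\<^sub>x L\<^sub>y\<close>; it is an inner mapping, hence an automorphism, and it fixes \<open>x\<close>.
  This yields power-associativity, the automorphic inverse property and
  \<open>T x\<inverse> y\<inverse> = T x y\<close>. The key point is that a product of two squares is a square:
  with \<open>u = T x y y\<close>, \<open>v = T y x x\<close> and \<open>s = u v\<inverse>\<close> one finds \<open>s x\<^sup>2 = u v = s\<inverse> y\<^sup>2\<close>,
  while \<open>a b = z\<^sup>2\<close> whenever \<open>s a = z = s\<inverse> b\<close>; so \<open>x\<^sup>2 y\<^sup>2 = (u v)\<^sup>2\<close>. As \<open>u v\<close> lies in every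
  normal subloop containing \<open>x\<close> and \<open>y\<close>, the sets \<open>K\<^sub>n\<close> are closed under multiplication by
  induction on \<open>n\<close>. In the finite case inversion is an involution of \<open>K\<close> fixing only the neutral
  element, since \<open>K\<close> has no elements of order 2.
\<close>

section \<open>Counting and arithmetic preliminaries\<close>

text \<open>Deleting one orbit \<open>{x, f x}\<close>, which has exactly two elements, leaves a
  smaller set still closed under \<open>f\<close>.\<close>

lemma even_card_fixpoint_free_involution:
  assumes "finite S" and "\<And>x. x \<in> S \<Longrightarrow> f x \<in> S" and "\<And>x. x \<in> S \<Longrightarrow> f (f x) = x"
    and "\<And>x. x \<in> S \<Longrightarrow> f x \<noteq> x"
  shows "even (card S)"
  using assms
proof (induction S rule: finite_psubset_induct)
  case (psubset S)
  show ?case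
  proof (cases "S = {}")
    case False
    then obtain x where x: "x \<in> S" by blast
    let ?S = "S - {x, f x}"
    have inv: "f y \<in> ?S" if "y \<in> ?S" for y
      using that psubset.prems(1,2) x by (metis DiffD1 DiffD2 DiffI insert_iff singletonD)
    have "even (card ?S)"
      using psubset.prems by (intro psubset.IH) (use x inv in auto)
    moreover have "card S = card ?S + card {x, f x}"
      using x psubset.prems(1) psubset.hyps
      by (metis bot_least card_Diff_subset card_mono finite.simps insert_subset le_add_diff_inverse2)
    moreover have "card {x, f x} = 2"
      using psubset.prems(3)[OF x] by (simp add: eq_commute)
    ultimately show ?thesis by simp
  qed simp
qed

lemma odd_part_exists:
  assumes "0 < (n::nat)"
  shows "\<exists>a b. n = 2 ^ a * b \<and> odd b"
  using assms
proof (induction n rule: less_induct)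
  case (less n)
  show ?case
  proof (cases "even n")
    case True
    then obtain k where k: "n = 2 * k" by blast
    then obtain a b where "k = 2 ^ a * b" "odd b"
      using less.IH[of k] less.prems by auto
    with k have "n = 2 ^ Suc a * b \<and> odd b" by simp
    then show ?thesis by blast
  next
    case False
    then have "n = 2 ^ 0 * n \<and> odd n" by simp
    then show ?thesis by blast
  qed
qed

section \<open>Division and inverses in a commutative A-loop\<close>

locale comm_automorphic_loop =
  fixes Q :: "'a set" and m :: "'a \<Rightarrow> 'a \<Rightarrow> 'a" (infixl "\<cdot>" 70) and e :: 'a
  assumes comm_A_loop: "comm_A_loop Q m e"
begin

definition ldiv :: "'a \<Rightarrow> 'a \<Rightarrow> 'a" where
  "ldiv x y = Ltr_inv Q m x y"

definition iv :: "'a \<Rightarrow> 'a" where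
  "iv x = ldiv x e"

text \<open>Built from \<open>Ltr\<close>, \<open>Ltr_inv\<close> and \<open>id\<close> in the shape
  of the rules of \<open>Mlt\<close>, so that those rules alone give membership.\<close>

definition T :: "'a \<Rightarrow> 'a \<Rightarrow> 'a \<Rightarrow> 'a" where
  "T x y = Ltr_inv Q m (x \<cdot> y) \<circ> (Ltr Q m x \<circ> (Ltr Q m y \<circ> id))"

abbreviation pw :: "'a \<Rightarrow> nat \<Rightarrow> 'a" where
  "pw \<equiv> lpow m e"

lemma loop: "loop Q m e"
  using comm_A_loop by (simp add: comm_A_loop_def)

lemma e_closed [simp]: "e \<in> Q"
  using loop by (simp add: loop_def)

lemma mult_closed [simp]: "x \<in> Q \<Longrightarrow> y \<in> Q \<Longrightarrow> x \<cdot> y \<in> Q"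
  using loop by (simp add: loop_def)

lemma e_left [simp]: "x \<in> Q \<Longrightarrow> e \<cdot> x = x"
  using loop by (simp add: loop_def)

lemma e_right [simp]: "x \<in> Q \<Longrightarrow> x \<cdot> e = x"
  using loop by (simp add: loop_def)

lemma commute: "x \<in> Q \<Longrightarrow> y \<in> Q \<Longrightarrow> x \<cdot> y = y \<cdot> x"
  using comm_A_loop by (simp add: comm_A_loop_def)

lemma bij_left: "x \<in> Q \<Longrightarrow> bij_betw (\<lambda>y. x \<cdot> y) Q Q"
  using loop by (simp add: loop_def)

lemma left_cancel: "x \<cdot> y = x \<cdot> z \<longleftrightarrow> y = z" if "x \<in> Q" "y \<in> Q" "z \<in> Q"
  using bij_left[OF that(1)] that by (auto simp: bij_betw_def inj_on_def)

lemma ldiv_props: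
  assumes "x \<in> Q" "y \<in> Q"
  shows "ldiv x y \<in> Q \<and> x \<cdot> ldiv x y = y"
proof -
  obtain z where "z \<in> Q" "x \<cdot> z = y"
    using bij_left[OF assms(1)] assms(2) by (metis bij_betw_imp_surj_on imageE)
  then have "\<exists>!z. z \<in> Q \<and> x \<cdot> z = y"
    using left_cancel assms by blast
  then have "(THE z. z \<in> Q \<and> x \<cdot> z = y) \<in> Q \<and> x \<cdot> (THE z. z \<in> Q \<and> x \<cdot> z = y) = y"
    by (rule theI')
  then show ?thesis
    using assms by (simp add: ldiv_def Ltr_inv_def)
qed

lemma ldiv_closed [simp]: "x \<in> Q \<Longrightarrow> y \<in> Q \<Longrightarrow> ldiv x y \<in> Q"
  and mult_ldiv [simp]: "x \<in> Q \<Longrightarrow> y \<in> Q \<Longrightarrow> x \<cdot> ldiv x y = y"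
  using ldiv_props by auto

lemma ldiv_eqI: "x \<in> Q \<Longrightarrow> z \<in> Q \<Longrightarrow> x \<cdot> z = y \<Longrightarrow> ldiv x y = z"
  using left_cancel ldiv_props mult_closed by metis

lemma iv_closed [simp]: "x \<in> Q \<Longrightarrow> iv x \<in> Q"
  and mult_iv [simp]: "x \<in> Q \<Longrightarrow> x \<cdot> iv x = e"
  by (simp_all add: iv_def)

lemma iv_mult [simp]: "x \<in> Q \<Longrightarrow> iv x \<cdot> x = e"
  by (simp add: commute)

lemma iv_eqI: "x \<in> Q \<Longrightarrow> z \<in> Q \<Longrightarrow> x \<cdot> z = e \<Longrightarrow> iv x = z"
  by (simp add: iv_def ldiv_eqI)

lemma iv_iv [simp]: "x \<in> Q \<Longrightarrow> iv (iv x) = x"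
  by (simp add: iv_eqI)

section \<open>Inner mappings as automorphisms\<close>

lemma Inn_aut: "f \<in> Inn Q m e \<Longrightarrow> loop_aut Q m f"
  using comm_A_loop by (simp add: comm_A_loop_def)

lemma Inn_bij: "f \<in> Inn Q m e \<Longrightarrow> bij_betw f Q Q"
  using Inn_aut by (simp add: loop_aut_def)

lemma Inn_mult: "f \<in> Inn Q m e \<Longrightarrow> x \<in> Q \<Longrightarrow> y \<in> Q \<Longrightarrow> f (x \<cdot> y) = f x \<cdot> f y"
  using Inn_aut by (simp add: loop_aut_def)

lemma Inn_e: "f \<in> Inn Q m e \<Longrightarrow> f e = e"
  by (simp add: Inn_def)

lemma T_eq_ldiv: "x \<in> Q \<Longrightarrow> y \<in> Q \<Longrightarrow> z \<in> Q \<Longrightarrow> T x y z = ldiv (x \<cdot> y) (x \<cdot> (y \<cdot> z))"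
  by (simp add: T_def ldiv_def Ltr_def)

lemma T_closed [simp]: "x \<in> Q \<Longrightarrow> y \<in> Q \<Longrightarrow> z \<in> Q \<Longrightarrow> T x y z \<in> Q"
  by (simp add: T_eq_ldiv)

lemma mult_T: "x \<in> Q \<Longrightarrow> y \<in> Q \<Longrightarrow> z \<in> Q \<Longrightarrow> (x \<cdot> y) \<cdot> T x y z = x \<cdot> (y \<cdot> z)"
  by (simp add: T_eq_ldiv)

lemma T_eqI:
  "x \<in> Q \<Longrightarrow> y \<in> Q \<Longrightarrow> z \<in> Q \<Longrightarrow> w \<in> Q \<Longrightarrow> (x \<cdot> y) \<cdot> w = x \<cdot> (y \<cdot> z) \<Longrightarrow> T x y z = w"
  by (simp add: T_eq_ldiv ldiv_eqI)

lemma T_Inn: "x \<in> Q \<Longrightarrow> y \<in> Q \<Longrightarrow> T x y \<in> Inn Q m e"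
proof -
  assume "x \<in> Q" "y \<in> Q"
  moreover from this have "T x y \<in> Mlt Q m"
    unfolding T_def by (intro Mlt.intros mult_closed)
  moreover have "T x y e = e"
    using calculation by (intro T_eqI) auto
  ultimately show ?thesis by (simp add: Inn_def)
qed

lemma T_mult:
  "x \<in> Q \<Longrightarrow> y \<in> Q \<Longrightarrow> z \<in> Q \<Longrightarrow> w \<in> Q \<Longrightarrow> T x y (z \<cdot> w) = T x y z \<cdot> T x y w"
  by (simp add: T_Inn Inn_mult)

lemma T_iv: "x \<in> Q \<Longrightarrow> y \<in> Q \<Longrightarrow> z \<in> Q \<Longrightarrow> T x y (iv z) = iv (T x y z)"
  by (rule iv_eqI[symmetric]) (simp_all add: T_mult[symmetric] Inn_e T_Inn)

text \<open>Commutativity alone gives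
  \<open>(x \<cdot> y) \<cdot> x = x \<cdot> (y \<cdot> x)\<close>.\<close>

lemma T_fixes: "x \<in> Q \<Longrightarrow> y \<in> Q \<Longrightarrow> T x y x = x"
  by (rule T_eqI) (simp_all add: commute)

section \<open>Powers and power-associativity\<close>

lemma lpow_closed [simp]: "x \<in> Q \<Longrightarrow> pw x n \<in> Q"
  by (induction n) simp_all

lemma lpow_e [simp]: "pw e n = e"
  by (induction n) simp_all

lemma Inn_lpow: "f \<in> Inn Q m e \<Longrightarrow> x \<in> Q \<Longrightarrow> f (pw x n) = pw (f x) n"
  by (induction n) (simp_all add: Inn_e Inn_mult)

lemma lpow_2: "x \<in> Q \<Longrightarrow> pw x 2 = x \<cdot> x"
  by (simp add: numeral_2_eq_2)

text \<open>The automorphism \<open>T x (pw x a)\<close> fixes \<open>x\<close>, hence every power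
  of \<open>x\<close>; so \<open>x\<close>, \<open>pw x a\<close> and \<open>pw x b\<close>
  associate.\<close>

lemma lpow_add: "x \<in> Q \<Longrightarrow> pw x (a + b) = pw x a \<cdot> pw x b"
proof (induction a)
  case (Suc a)
  have "T x (pw x a) (pw x b) = pw x b"
    using Suc.prems Inn_lpow[OF T_Inn, of x "pw x a" x b] by (simp add: T_fixes)
  then show ?case
    using Suc mult_T[of x "pw x a" "pw x b"] by simp
qed simp

lemma lpow_mult: "x \<in> Q \<Longrightarrow> pw x (a * b) = pw (pw x a) b"
  by (induction b) (simp_all add: lpow_add)

section \<open>The automorphic inverse property and its consequences\<close>

text \<open>With \<open>S = T x y\<close> one has \<open>S y\<inverse> \<cdot> (x \<cdot> y) = x = S x\<close>, so \<open>S\<close> maps the solution \<open>w\<close> of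
  \<open>y\<inverse> \<cdot> w = x\<close> to \<open>x \<cdot> y\<close>; inverting this gives \<open>y \<cdot> w\<inverse> = x\<inverse>\<close>.\<close>

lemma iv_mult_iv_left:
  assumes "y \<in> Q" "w \<in> Q"
  shows "y \<cdot> iv w = iv (iv y \<cdot> w)"
proof -
  define x where "x = iv y \<cdot> w"
  have x: "x \<in> Q" using assms by (simp add: x_def)
  have "(x \<cdot> y) \<cdot> T x y (iv y) = x"
    using assms x by (simp add: mult_T)
  moreover have "T x y (iv y) \<cdot> T x y w = x"
    using assms x T_fixes[of x y] by (simp add: T_mult[symmetric] x_def[symmetric])
  ultimately have "T x y w = x \<cdot> y"
    using assms x by (metis T_closed commute iv_closed left_cancel mult_closed)
  then have "x \<cdot> (y \<cdot> iv w) = e"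
    using assms x by (simp add: mult_T[symmetric] T_iv)
  then have "iv x = y \<cdot> iv w"
    using assms x by (intro iv_eqI) simp_all
  then show ?thesis
    by (simp add: x_def)
qed

lemma automorphic_inverse: "x \<in> Q \<Longrightarrow> y \<in> Q \<Longrightarrow> iv (x \<cdot> y) = iv x \<cdot> iv y"
  using iv_mult_iv_left[of "iv x" y] by simp

lemma iv_lpow: "x \<in> Q \<Longrightarrow> iv (pw x n) = pw (iv x) n"
  by (induction n) (simp_all add: automorphic_inverse iv_eqI)

text \<open>Conjugating \<open>T x y\<close> by inversion, now an automorphism, gives
  \<open>T (iv x) (iv y)\<close>; but \<open>T x y\<close> commutes with inversion by
  \<open>T_iv\<close>.\<close>

lemma T_iv_iv:
  assumes "x \<in> Q" "y \<in> Q" "z \<in> Q"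
  shows "T (iv x) (iv y) z = T x y z"
proof (rule T_eqI)
  have "iv ((x \<cdot> y) \<cdot> T x y (iv z)) = iv (x \<cdot> (y \<cdot> iv z))"
    using assms by (simp add: mult_T)
  then show "(iv x \<cdot> iv y) \<cdot> T x y z = iv x \<cdot> (iv y \<cdot> z)"
    using assms by (simp add: automorphic_inverse T_iv)
qed (use assms in auto)

text \<open>\<open>T x y\<close> fixes \<open>x\<close>, hence also \<open>iv x\<close>.\<close>

lemma iv_left_commute:
  assumes "x \<in> Q" "y \<in> Q"
  shows "iv x \<cdot> (x \<cdot> y) = x \<cdot> (iv x \<cdot> y)"
proof -
  have "T x y (iv x) = iv x"
    using assms by (simp add: T_iv T_fixes)
  then have "(x \<cdot> y) \<cdot> iv x = x \<cdot> (y \<cdot> iv x)"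
    using assms mult_T[of x y "iv x"] by simp
  then show ?thesis
    using assms by (simp add: commute)
qed

section \<open>Products of squares\<close>

text \<open>Writing \<open>a = iv s \<cdot> k\<close> forces \<open>b = s \<cdot> k\<close>, so the
  claim reduces to \<open>T a s k = a \<cdot> s\<close>.\<close>

lemma mult_eq_square:
  assumes "s \<in> Q" "a \<in> Q" "b \<in> Q" and eq: "s \<cdot> a = iv s \<cdot> b"
  shows "a \<cdot> b = (s \<cdot> a) \<cdot> (s \<cdot> a)"
proof -
  define k where "k = ldiv (iv s) a"
  have k: "k \<in> Q" "iv s \<cdot> k = a"
    using assms by (simp_all add: k_def)
  have "iv s \<cdot> (s \<cdot> k) = iv s \<cdot> b"
    using assms k by (simp add: iv_left_commute)
  then have b: "b = s \<cdot> k"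
    using assms k by (simp add: left_cancel)
  \<comment> \<open>Both sides of the equation required by \<open>T_eqI\<close> equal
    \<open>e\<close>, since \<open>iv s \<cdot> k = a\<close>.\<close>
  have "T (iv a) (iv s) k = a \<cdot> s"
    using assms k by (intro T_eqI) (simp_all flip: automorphic_inverse)
  then have "T a s k = a \<cdot> s"
    using assms k by (simp add: T_iv_iv)
  then show ?thesis
    using assms k mult_T[of a s k] by (simp add: b commute[of s a])
qed

text \<open>With \<open>L\<close> for left translations and \<open>T = T x y\<close>, this is
  \<open>T L_xy = L_x L_(T y)\<close>: the automorphism \<open>T\<close> conjugates
  \<open>L_x L_y = L_xy T\<close> to \<open>L_x L_(T y)\<close>, because it fixes
  \<open>x\<close>.\<close>

lemma T_mult_product:
  assumes "x \<in> Q" "y \<in> Q" "z \<in> Q"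
  shows "T x y ((x \<cdot> y) \<cdot> z) = x \<cdot> (T x y y \<cdot> z)"
proof -
  \<comment> \<open>The preimage of \<open>z\<close> under \<open>T x y\<close>.\<close>
  define w where "w = ldiv y (ldiv x ((x \<cdot> y) \<cdot> z))"
  have w: "w \<in> Q" "x \<cdot> (y \<cdot> w) = (x \<cdot> y) \<cdot> z"
    using assms by (simp_all add: w_def)
  have "T x y w = z"
    using assms w by (intro T_eqI) simp_all
  then have "x \<cdot> (T x y y \<cdot> z) = T x y x \<cdot> (T x y y \<cdot> T x y w)"
    using assms by (simp add: T_fixes)
  also have "\<dots> = T x y (x \<cdot> (y \<cdot> w))"
    using assms w(1) by (simp add: T_mult)
  finally show ?thesis by (simp add: w)
qed

lemma mult_T_iv:
  assumes "x \<in> Q" "y \<in> Q"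
  shows "(x \<cdot> y) \<cdot> iv (T x y y) = x"
  using assms mult_T[of x y "iv y"] by (simp add: T_iv)

text \<open>Put \<open>z = iv (T y x x)\<close> in \<open>T_mult_product\<close>: by
  \<open>mult_T_iv\<close> the argument of \<open>T x y\<close> collapses to
  \<open>y\<close>.\<close>

lemma mult_T_div_T:
  assumes "x \<in> Q" "y \<in> Q"
  shows "x \<cdot> (T x y y \<cdot> iv (T y x x)) = T x y y"
  using assms T_mult_product[of x y "iv (T y x x)"] mult_T_iv[of y x] by (simp add: commute[of y x])

lemma square_mult_T:
  assumes "x \<in> Q" "y \<in> Q"
  shows "(T x y y \<cdot> iv (T y x x)) \<cdot> (x \<cdot> x) = T x y y \<cdot> T y x x"
proof -
  define u v s where "u = T x y y" and "v = T y x x" and "s = u \<cdot> iv v"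
  have Q: "u \<in> Q" "v \<in> Q" "s \<in> Q" using assms by (simp_all add: u_def v_def s_def)
  have xs: "x \<cdot> s = u"
    using assms mult_T_div_T by (simp add: u_def v_def s_def)
  have ivs: "iv s = v \<cdot> iv u"
    using Q by (simp add: s_def automorphic_inverse commute)
  have ixs: "iv s \<cdot> iv x = iv u"
    using Q assms xs by (metis automorphic_inverse commute)
  \<comment> \<open>Both sides are \<open>iv s\<close>: the left one is
    \<open>iv u \<cdot> v\<close>, the right one has \<open>iv x \<cdot> x = e\<close>.\<close>
  have "(iv s \<cdot> iv x) \<cdot> v = iv s \<cdot> (iv x \<cdot> x)"
    unfolding ixs using Q assms by (simp add: ivs commute)
  then have "T (iv s) (iv x) x = v"
    using Q assms by (intro T_eqI) simp_all
  then have "T s x x = v"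
    using Q assms by (simp add: T_iv_iv)
  then show ?thesis
    using Q assms mult_T[of s x x] xs by (simp add: u_def v_def s_def commute)
qed

lemma square_mult_square:
  assumes "x \<in> Q" "y \<in> Q"
  shows "(x \<cdot> x) \<cdot> (y \<cdot> y) = (T x y y \<cdot> T y x x) \<cdot> (T x y y \<cdot> T y x x)"
proof -
  define u v s where "u = T x y y" and "v = T y x x" and "s = u \<cdot> iv v"
  have Q: "u \<in> Q" "v \<in> Q" "s \<in> Q" using assms by (simp_all add: u_def v_def s_def)
  have ivs: "iv s = v \<cdot> iv u"
    using Q by (simp add: s_def automorphic_inverse commute)
  have 1: "s \<cdot> (x \<cdot> x) = u \<cdot> v"
    using assms square_mult_T by (simp add: u_def v_def s_def)
  \<comment> \<open>Exchanging \<open>x\<close> and \<open>y\<close> swaps \<open>u\<close> with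
    \<open>v\<close> and so turns \<open>s\<close> into \<open>iv s\<close>.\<close>
  have 2: "iv s \<cdot> (y \<cdot> y) = u \<cdot> v"
    using assms square_mult_T[of y x] Q by (simp add: ivs u_def v_def commute)
  show ?thesis
    using mult_eq_square[of s "x \<cdot> x" "y \<cdot> y"] 1 2 Q assms by (simp add: u_def v_def)
qed

section \<open>The sets \<open>Kn\<close> as normal subloops\<close>

lemma Kn_0: "Kn Q m e 0 = Q"
  by (auto simp: Kn_def) (metis e_right)

lemma Kn_Suc: "Kn Q m e (Suc n) = {pw x 2 | x. x \<in> Kn Q m e n}"
proof -
  have "pw x (2 ^ Suc n) = pw (pw x (2 ^ n)) 2" if "x \<in> Q" for x
    using that lpow_mult[of x "2 ^ n" 2] by (simp add: mult.commute)
  then show ?thesis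
    unfolding Kn_def by (intro equalityI subsetI; simp only: mem_Collect_eq; metis)
qed

text \<open>Here the squaring is done first, whereas \<open>Kn_Suc\<close> does it last.\<close>

lemma Kn_Suc_subset: "Kn Q m e (Suc n) \<subseteq> Kn Q m e n"
proof
  fix z assume "z \<in> Kn Q m e (Suc n)"
  then obtain x where "x \<in> Q" "z = pw x (2 ^ Suc n)"
    by (auto simp: Kn_def)
  then have "z = pw (pw x 2) (2 ^ n)"
    using lpow_mult[of x 2 "2 ^ n"] by simp
  then show "z \<in> Kn Q m e n"
    using \<open>x \<in> Q\<close> lpow_closed unfolding Kn_def by blast
qed

lemma Kn_subset: "Kn Q m e n \<subseteq> Q"
  by (auto simp: Kn_def)

lemma e_Kn: "e \<in> Kn Q m e n"
  unfolding Kn_def using e_closed lpow_e by (metis (mono_tags, lifting) mem_Collect_eq)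

lemma iv_Kn: "x \<in> Kn Q m e n \<Longrightarrow> iv x \<in> Kn Q m e n"
  unfolding Kn_def using iv_lpow iv_closed by blast

text \<open>An automorphism permutes \<open>Q\<close> and commutes with powers. Equality, not just
  inclusion, lets membership be pulled back in \<open>Inn_Kn_iff\<close>.\<close>

lemma Inn_image_Kn:
  assumes f: "f \<in> Inn Q m e"
  shows "f ` Kn Q m e n = Kn Q m e n"
proof -
  have "f ` Kn Q m e n = (\<lambda>x. f (pw x (2 ^ n))) ` Q"
    by (auto simp: Kn_def)
  also have "\<dots> = (\<lambda>x. pw (f x) (2 ^ n)) ` Q"
    using Inn_lpow[OF f] by (intro image_cong) auto
  also have "\<dots> = (\<lambda>x. pw x (2 ^ n)) ` f ` Q"
    by (simp add: image_image)
  also have "\<dots> = Kn Q m e n"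
    using Inn_bij[OF f] by (auto simp: Kn_def bij_betw_def)
  finally show ?thesis .
qed

lemma Inn_Kn_iff: "f \<in> Inn Q m e \<Longrightarrow> x \<in> Q \<Longrightarrow> f x \<in> Kn Q m e n \<longleftrightarrow> x \<in> Kn Q m e n"
  using Inn_image_Kn[of f n] Inn_bij[of f] Kn_subset[of n]
  by (metis bij_betw_imp_inj_on inj_on_image_mem_iff)

text \<open>Square roots \<open>a\<close>, \<open>b\<close> of the factors lie one level lower;
  inner mappings keep \<open>T a b b\<close> and \<open>T b a a\<close> there, and the induction
  hypothesis covers their product, whose square is \<open>x \<cdot> y\<close>.\<close>

lemma mult_Kn: "x \<in> Kn Q m e n \<Longrightarrow> y \<in> Kn Q m e n \<Longrightarrow> x \<cdot> y \<in> Kn Q m e n"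
proof (induction n arbitrary: x y)
  case 0
  then show ?case by (simp add: Kn_0)
next
  case (Suc n)
  then obtain a b where ab: "a \<in> Kn Q m e n" "b \<in> Kn Q m e n" and "x = pw a 2" "y = pw b 2"
    by (auto simp: Kn_Suc)
  moreover have Q: "a \<in> Q" "b \<in> Q"
    using ab Kn_subset by auto
  ultimately have "x \<cdot> y = pw (T a b b \<cdot> T b a a) 2"
    by (simp add: lpow_2 square_mult_square)
  moreover have "T a b b \<cdot> T b a a \<in> Kn Q m e n"
    using Q ab by (intro Suc.IH) (simp_all add: Inn_Kn_iff T_Inn)
  ultimately show ?case
    unfolding Kn_Suc by blast
qed

text \<open>Multiplying by \<open>iv x\<close> need not recover \<open>z\<close>, but it yields the
  image of \<open>z\<close> under the inner mapping \<open>T (iv x) x\<close>, which preserves and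
  reflects membership.\<close>

lemma Kn_mult_cancel:
  assumes "x \<in> Kn Q m e n" "z \<in> Q" "x \<cdot> z \<in> Kn Q m e n"
  shows "z \<in> Kn Q m e n"
proof -
  have x: "x \<in> Q" using assms Kn_subset by auto
  have "T (iv x) x z = iv x \<cdot> (x \<cdot> z)"
    using x assms by (intro T_eqI) simp_all
  then have "T (iv x) x z \<in> Kn Q m e n"
    using assms by (simp add: iv_Kn mult_Kn)
  then show ?thesis
    using x assms by (simp add: Inn_Kn_iff T_Inn)
qed

lemma normal_subloop_Kn: "normal_subloop Q m e (Kn Q m e n)"
  unfolding normal_subloop_def subloop_def
proof (intro conjI ballI impI)
  fix x y z assume K: "x \<in> Kn Q m e n" "y \<in> Kn Q m e n" and z: "z \<in> Q"
  have x: "x \<in> Q" using K Kn_subset by blast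
  show "z \<in> Kn Q m e n" if "x \<cdot> z = y"
    using K z that Kn_mult_cancel[of x n z] by simp
  show "z \<in> Kn Q m e n" if "z \<cdot> x = y"
    using K z that commute[OF x z] Kn_mult_cancel[of x n z] by simp
qed (use Kn_subset in \<open>simp_all add: e_Kn mult_Kn Inn_image_Kn\<close>)

section \<open>Intersections of normal subloops\<close>

lemma normal_subloop_INT:
  assumes "I \<noteq> {}" and normal: "\<And>i. i \<in> I \<Longrightarrow> normal_subloop Q m e (S i)"
  shows "normal_subloop Q m e (\<Inter>i\<in>I. S i)"
proof -
  have S: "S i \<subseteq> Q" "e \<in> S i" "\<forall>x\<in>S i. \<forall>y\<in>S i. x \<cdot> y \<in> S i"
    "\<forall>x\<in>S i. \<forall>y\<in>S i. \<forall>z\<in>Q. (x \<cdot> z = y \<longrightarrow> z \<in> S i) \<and> (z \<cdot> x = y \<longrightarrow> z \<in> S i)"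
    "\<forall>f\<in>Inn Q m e. f ` S i \<subseteq> S i" if "i \<in> I" for i
    using normal[OF that] unfolding normal_subloop_def subloop_def by - (elim conjE, assumption)+
  show ?thesis
    unfolding normal_subloop_def subloop_def
  proof (intro conjI ballI impI INT_I)
    show "(\<Inter>i\<in>I. S i) \<subseteq> Q"
      using S(1) assms(1) by blast
    show "f ` (\<Inter>i\<in>I. S i) \<subseteq> (\<Inter>i\<in>I. S i)" if "f \<in> Inn Q m e" for f
      using S(5) that by blast
  next
    fix i assume i: "i \<in> I"
    then show "e \<in> S i" by (rule S(2))
    fix x y assume "x \<in> (\<Inter>i\<in>I. S i)" "y \<in> (\<Inter>i\<in>I. S i)"
    then have xy: "x \<in> S i" "y \<in> S i" using i by auto
    then show "x \<cdot> y \<in> S i" using S(3)[OF i] by simp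
    fix z assume "z \<in> Q"
    note S(4)[OF i, rule_format, OF xy this]
    then show "x \<cdot> z = y \<Longrightarrow> z \<in> S i" "z \<cdot> x = y \<Longrightarrow> z \<in> S i" by auto
  qed
qed

lemma normal_subloop_Kinf: "normal_subloop Q m e (Kinf Q m e)"
  unfolding Kinf_def by (rule normal_subloop_INT) (auto simp: normal_subloop_Kn)

section \<open>Orders of elements in the finite case\<close>

text \<open>Pigeonhole on the \<open>card Q + 1\<close> exponents from 0 to
  \<open>card Q\<close>.\<close>

lemma lpow_eq_e_bounded:
  assumes "finite Q" "x \<in> Q"
  shows "\<exists>k. 0 < k \<and> k \<le> card Q \<and> pw x k = e"
proof -
  have "\<not> inj_on (pw x) {0..card Q}"
  proof
    assume "inj_on (pw x) {0..card Q}"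
    moreover have "pw x ` {0..card Q} \<subseteq> Q" using assms by auto
    ultimately have "card {0..card Q} \<le> card Q"
      using assms card_inj_on_le by blast
    then show False by simp
  qed
  then obtain i j where ij: "i < j" "j \<le> card Q" "pw x i = pw x j"
    unfolding inj_on_def by (metis atLeastAtMost_iff linorder_neqE_nat)
  have "pw x i \<cdot> pw x (j - i) = pw x (i + (j - i))"
    using assms by (simp only: lpow_add)
  also have "\<dots> = pw x i \<cdot> e"
    using ij assms by simp
  finally have "pw x i \<cdot> pw x (j - i) = pw x i \<cdot> e" .
  then have "pw x (j - i) = e"
    using assms by (simp only: left_cancel lpow_closed e_closed)
  then show ?thesis
    using ij by (intro exI[of _ "j - i"]) auto
qed

lemma lord_props:
  assumes "finite Q" "x \<in> Q"
  shows "0 < lord m e x" "lord m e x \<le> card Q" "pw x (lord m e x) = e"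
proof -
  obtain k where k: "0 < k" "k \<le> card Q" "pw x k = e"
    using lpow_eq_e_bounded[OF assms] by blast
  then have "0 < lord m e x \<and> pw x (lord m e x) = e"
    unfolding lord_def by (metis (mono_tags, lifting) LeastI)
  then show "0 < lord m e x" "pw x (lord m e x) = e" by auto
  have "lord m e x \<le> k"
    unfolding lord_def using k by (intro Least_le) simp
  then show "lord m e x \<le> card Q" using k by simp
qed

lemma lpow_lord_mult:
  assumes "finite Q" "x \<in> Q"
  shows "pw x (lord m e x * a) = e"
  using assms by (simp add: lpow_mult lord_props)

lemma lpow_eq_e_iff:
  assumes "finite Q" "x \<in> Q"
  shows "pw x n = e \<longleftrightarrow> lord m e x dvd n"
proof
  assume n: "pw x n = e"
  let ?k = "lord m e x"
  have "pw x n = pw x (?k * (n div ?k)) \<cdot> pw x (n mod ?k)"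
    using assms by (simp flip: lpow_add)
  then have "pw x (n mod ?k) = e"
    using n assms by (simp add: lpow_lord_mult)
  moreover have "n mod ?k < ?k"
    using lord_props[OF assms] by simp
  moreover have "\<not> (0 < n mod ?k \<and> pw x (n mod ?k) = e)"
    using \<open>n mod ?k < ?k\<close> unfolding lord_def by (rule not_less_Least)
  ultimately have "n mod ?k = 0" by simp
  then show "?k dvd n" by (simp add: mod_eq_0_iff_dvd)
next
  assume "lord m e x dvd n"
  then show "pw x n = e"
    using assms by (auto simp: lpow_lord_mult)
qed

text \<open>If the order is \<open>2 * j + 1\<close>, then \<open>pw x (j + 1)\<close> is a square
  root of \<open>x\<close>. Its order divides that of \<open>x\<close>, so root extraction can be
  iterated.\<close>

lemma odd_lord_imp_square:
  assumes "finite Q" "x \<in> Q" "odd (lord m e x)"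
  obtains y where "y \<in> Q" "odd (lord m e y)" "x = pw y 2"
proof -
  obtain j where j: "lord m e x = 2 * j + 1"
    using assms(3) by (elim oddE)
  define y where "y = pw x (j + 1)"
  have y: "y \<in> Q" using assms by (simp add: y_def)
  have "pw y 2 = pw x ((j + 1) * 2)"
    unfolding y_def using assms by (simp only: lpow_mult)
  also have "(j + 1) * 2 = lord m e x + 1"
    by (simp add: j)
  also have "pw x (lord m e x + 1) = x"
    using assms by (simp add: lord_props)
  finally have "pw y 2 = x" .
  moreover have "pw y (lord m e x) = pw x (lord m e x * (j + 1))"
    unfolding y_def using assms by (metis lpow_mult mult.commute)
  then have "lord m e y dvd lord m e x"
    using assms y by (simp only: lpow_lord_mult lpow_eq_e_iff[symmetric])
  then have "odd (lord m e y)"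
    using assms(3) dvd_trans by blast
  ultimately show ?thesis
    using y that by blast
qed

lemma odd_lord_in_Kn:
  assumes "finite Q"
  shows "x \<in> Q \<Longrightarrow> odd (lord m e x) \<Longrightarrow> x \<in> Kn Q m e n"
proof (induction n arbitrary: x)
  case 0
  then show ?case by (simp add: Kn_0)
next
  case (Suc n)
  then obtain y where "y \<in> Q" "odd (lord m e y)" "x = pw y 2"
    using odd_lord_imp_square[OF assms] by blast
  then show ?case
    using Suc.IH unfolding Kn_Suc by blast
qed

section \<open>Odd order and parity of \<open>Kinf\<close> in the finite case\<close>

lemma Kinf_eq_odd_lord:
  assumes fin: "finite Q"
  shows "Kinf Q m e = {x \<in> Q. odd (lord m e x)}"
proof (intro equalityI subsetI)
  fix x assume "x \<in> Kinf Q m e"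
  moreover have "card Q \<ge> 1"
    using fin e_closed by (metis One_nat_def Suc_leI card_gt_0_iff empty_iff)
  \<comment> \<open>The single level \<open>card Q\<close> suffices: the 2-part of any order is at
    most \<open>card Q\<close>, hence divides \<open>2 ^ card Q\<close>, and the power
    \<open>x\<close> of \<open>y\<close> retains only odd order.\<close>
  ultimately have "x \<in> Kn Q m e (card Q)"
    by (auto simp: Kinf_def)
  then obtain y where y: "y \<in> Q" and x: "x = pw y (2 ^ card Q)"
    by (auto simp: Kn_def)
  note ly = lord_props[OF fin y]
  obtain a b where ab: "lord m e y = 2 ^ a * b" "odd b"
    using odd_part_exists[OF ly(1)] by blast
  have "b \<ge> 1" using ab(2) by (cases b) auto
  then have "2 ^ a \<le> card Q"
    using ly(2) ab(1) by (metis dual_order.trans mult_le_mono2 nat_mult_1_right)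
  then have "(2::nat) ^ a < 2 ^ card Q"
    using less_exp order_le_less_trans by blast
  then have "a \<le> card Q"
    by simp
  then have "lord m e y dvd 2 ^ card Q * b"
    by (simp add: ab(1) le_imp_power_dvd mult_dvd_mono)
  then have "pw x b = e"
    using fin y by (simp add: x lpow_eq_e_iff flip: lpow_mult)
  then have "lord m e x dvd b"
    using fin y x by (simp add: lpow_eq_e_iff)
  then show "x \<in> {x \<in> Q. odd (lord m e x)}"
    using ab(2) x y dvd_trans by auto
next
  fix x assume "x \<in> {x \<in> Q. odd (lord m e x)}"
  then show "x \<in> Kinf Q m e"
    using odd_lord_in_Kn[OF fin] by (auto simp: Kinf_def)
qed

lemma odd_card_Kinf:
  assumes fin: "finite Q"
  shows "odd (card (Kinf Q m e))"
proof -
  let ?K = "Kinf Q m e"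
  have sub: "?K \<subseteq> Q" and e: "e \<in> ?K"
    using Kinf_eq_odd_lord[OF fin] e_Kn by (auto simp: Kinf_def)
  have iv: "iv x \<in> ?K" if "x \<in> ?K" for x
    using that iv_Kn by (auto simp: Kinf_def)
  have no_fix: "iv x \<noteq> x" if x: "x \<in> ?K" "x \<noteq> e" for x
  proof
    assume "iv x = x"
    moreover have xQ: "x \<in> Q" using sub x by auto
    ultimately have "pw x 2 = e"
      using mult_iv[of x] by (simp add: lpow_2)
    then have "lord m e x \<le> 2"
      using lpow_eq_e_iff[OF fin xQ] by (simp add: dvd_imp_le)
    moreover have "odd (lord m e x)"
      using x Kinf_eq_odd_lord[OF fin] by simp
    \<comment> \<open>An odd number that is at most 2.\<close>
    ultimately have "lord m e x = 1"
      by (auto elim!: oddE)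
    then show False
      using lord_props(3)[OF fin xQ] xQ x by simp
  qed
  have "even (card (?K - {e}))"
  proof (rule even_card_fixpoint_free_involution[where f = iv])
    show "finite (?K - {e})" using fin sub finite_subset by blast
    show "iv x \<in> ?K - {e}" if "x \<in> ?K - {e}" for x
    proof -
      have "x \<in> Q" using that sub by auto
      then have "iv x \<noteq> e" using that by (metis Diff_iff e_right mult_iv singletonI)
      then show ?thesis using that iv by auto
    qed
  qed (use sub no_fix in auto)
  moreover have "card ?K = Suc (card (?K - {e}))"
    using e fin sub finite_subset by (metis card.remove)
  ultimately show ?thesis by simp
qed

end

theorem theorem5p3:
  fixes Q :: "'a set" and m :: "'a \<Rightarrow> 'a \<Rightarrow> 'a" and e :: 'a
  assumes "comm_A_loop Q m e"
  shows "(\<forall>n. Kn Q m e (Suc n) = {lpow m e x 2 | x. x \<in> Kn Q m e n})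
    \<and> (\<forall>n. Kn Q m e (Suc n) \<subseteq> Kn Q m e n)
    \<and> (\<forall>n. normal_subloop Q m e (Kn Q m e n))
    \<and> normal_subloop Q m e (Kinf Q m e)
    \<and> (finite Q \<longrightarrow> Kinf Q m e = {x \<in> Q. odd (lord m e x)} \<and> odd (card (Kinf Q m e)))"
proof -
  interpret comm_automorphic_loop Q m e
    using assms by unfold_locales
  show ?thesis
    using Kn_Suc Kn_Suc_subset normal_subloop_Kn normal_subloop_Kinf Kinf_eq_odd_lord odd_card_Kinf
    by blast
qed

end
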